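(* Let $\mathcal{H}$ be a complex Hilbert space and let $A\in\mathcal{B}(\mathcal{H})$. Then for any $0\le t\le 1$, \[2\sqrt{(1-t)^3}\left\|\mathfrak{R}A\right\|+\left|\,\left\|\sqrt{(1-t)^3}\,\mathfrak{R}A+\sqrt{t^3}\,\mathfrak{I}A\right\|-\left\|\sqrt{(1-t)^3}\,\mathfrak{R}A-\sqrt{t^3}\,\mathfrak{I}A\right\|\,\right|\le\omega_t(A).\] In particular, \[\frac{1}{\sqrt2}\left\|\mathfrak{R}A\right\|+\frac{1}{2\sqrt2}\left|\,\left\|\mathfrak{R}A+\mathfrak{I}A\right\|-\left\|\mathfrak{R}A-\mathfrak{I}A\right\|\,\right|\le\omega(A).\]
   Context: $\mathcal{B}(\mathcal{H})$ is the $C^*$-algebra of bounded linear operators on the complex Hilbert space $\mathcal{H}$, with operator norm $\|\cdot\|$. $\mathfrak{R}A=\frac{A+A^*}{2}$ and $\mathfrak{I}A=\frac{A-A^*}{2\mathrm{i}}$. The numerical radius is $\omega(A)=\sup_{\|x\|=1}|\langle Ax,x\rangle|$. For $0\le t\le 1$, the $t$-weighted numerical radius of $A$ is $\omega_t(A)=\omega\left((1-2t)A^*+A\right)$. *)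

theory Defs
  imports "HOL-Analysis.Analysis"
begin

text \<open>
  Complex inner product spaces and complex Hilbert spaces as type classes on top of
  \<^class>\<open>real_normed_vector\<close>, so that the library's \<^const>\<open>norm\<close>, \<^const>\<open>onorm\<close> and
  \<^const>\<open>bounded_linear\<close> apply. The inner product is linear in its first argument.
  Axiom \<open>scaleC_of_real\<close> identifies the underlying real structure with the restriction of
  scalars and contains \<open>1 *\<^sub>C x = x\<close>.
\<close>

class complex_inner = real_normed_vector +
  fixes scaleC :: "complex \<Rightarrow> 'a \<Rightarrow> 'a"  (infixr "*\<^sub>C" 75)
    and cinner :: "'a \<Rightarrow> 'a \<Rightarrow> complex"
  assumes scaleC_add_right: "c *\<^sub>C (x + y) = c *\<^sub>C x + c *\<^sub>C y"
    and scaleC_add_left: "(c + d) *\<^sub>C x = c *\<^sub>C x + d *\<^sub>C x"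
    and scaleC_scaleC: "c *\<^sub>C d *\<^sub>C x = (c * d) *\<^sub>C x"
    and scaleC_of_real: "complex_of_real r *\<^sub>C x = r *\<^sub>R x"
    and cinner_commute: "cinner x y = cnj (cinner y x)"
    and cinner_add_left: "cinner (x + y) z = cinner x z + cinner y z"
    and cinner_scaleC_left: "cinner (c *\<^sub>C x) y = c * cinner x y"
    and cinner_self_nonneg: "0 \<le> Re (cinner x x)"
    and cinner_self_eq_zero_iff: "cinner x x = 0 \<longleftrightarrow> x = 0"
    and norm_eq_sqrt_cinner: "norm x = sqrt (Re (cinner x x))"

class chilbert_space = complex_inner + complete_space

instantiation complex :: chilbert_space
begin

definition scaleC_complex :: "complex \<Rightarrow> complex \<Rightarrow> complex"
  where "scaleC_complex c x = c * x"

definition cinner_complex :: "complex \<Rightarrow> complex \<Rightarrow> complex"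
  where "cinner_complex x y = x * cnj y"

instance
  by standard
    (auto simp: scaleC_complex_def cinner_complex_def algebra_simps scaleR_conv_of_real
      cmod_def power2_eq_square)

end

definition bounded_clinear :: "('a::complex_inner \<Rightarrow> 'b::complex_inner) \<Rightarrow> bool"
  where "bounded_clinear A \<longleftrightarrow> bounded_linear A \<and> (\<forall>c x. A (c *\<^sub>C x) = c *\<^sub>C A x)"

text \<open>
  For a bounded operator on a Hilbert space the adjoint exists by the Riesz representation
  theorem; it is unique by definiteness of the inner product.
\<close>

definition cadjoint :: "('a::chilbert_space \<Rightarrow> 'a) \<Rightarrow> 'a \<Rightarrow> 'a"
  where "cadjoint A = (THE B. \<forall>x y. cinner (A x) y = cinner x (B y))"

definition Re_op :: "('a::chilbert_space \<Rightarrow> 'a) \<Rightarrow> 'a \<Rightarrow> 'a"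
  where "Re_op A = (\<lambda>x. (1 / 2) *\<^sub>C (A x + cadjoint A x))"

definition Im_op :: "('a::chilbert_space \<Rightarrow> 'a) \<Rightarrow> 'a \<Rightarrow> 'a"
  where "Im_op A = (\<lambda>x. (1 / (2 * \<i>)) *\<^sub>C (A x - cadjoint A x))"

text \<open>
  The supremum is taken in \<open>[0, \<infinity>)\<close>: the element 0 only matters on the zero space, which has
  no unit vectors and where \<^const>\<open>Sup\<close> of the empty set of reals is an unspecified value.
\<close>

definition numerical_radius :: "('a::chilbert_space \<Rightarrow> 'a) \<Rightarrow> real"
  where "numerical_radius A = Sup (insert 0 {cmod (cinner (A x) x) | x. norm x = 1})"

definition weighted_numerical_radius :: "real \<Rightarrow> ('a::chilbert_space \<Rightarrow> 'a) \<Rightarrow> real"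
  where "weighted_numerical_radius t A =
    numerical_radius (\<lambda>x. (1 - 2 * t) *\<^sub>R cadjoint A x + A x)"

end

theory Submission
  imports Defs
begin

text \<open>
  Put \<open>a = sqrt ((1 - t)\<^sup>3)\<close>, \<open>b = sqrt (t\<^sup>3)\<close>, and let \<open>P\<close>, \<open>Q\<close> be the norms of the
  self-adjoint operators \<open>a R + b I\<close> and \<open>a R - b I\<close>, where \<open>A = R + \<i> I\<close>. The triangle
  inequality gives \<open>2 a \<parallel>R\<parallel> \<le> P + Q\<close>, so the left-hand side is at most
  \<open>P + Q + \<bar>P - Q\<bar> = 2 max P Q\<close>. Since the norm of a self-adjoint operator is its numerical
  radius, and since for \<open>\<langle>Ax, x\<rangle> = r + \<i> s\<close> Cauchy-Schwarz gives
  \<open>\<bar>a r \<plusminus> b s\<bar> \<le> sqrt ((1 - t) + t) * sqrt ((1 - t)\<^sup>2 r\<^sup>2 + t\<^sup>2 s\<^sup>2)\<close>, both \<open>2 P\<close> and \<open>2 Q\<close> are bounded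
  by the supremum of \<open>\<bar>2 (1 - t) r + 2 t s \<i>\<bar>\<close>, which is the weighted numerical radius.
  The second inequality is the case \<open>t = 1/2\<close>.
\<close>

section \<open>Complex inner product spaces\<close>

lemma cinner_add_right:
  fixes x y z :: "'a::complex_inner"
  shows "cinner x (y + z) = cinner x y + cinner x z"
  by (metis cinner_add_left cinner_commute complex_cnj_add)

lemma cinner_scaleC_right:
  fixes x y :: "'a::complex_inner"
  shows "cinner x (c *\<^sub>C y) = cnj c * cinner x y"
  by (metis cinner_scaleC_left cinner_commute complex_cnj_mult)

lemma cinner_scaleR_left:
  fixes x y :: "'a::complex_inner"
  shows "cinner (r *\<^sub>R x) y = of_real r * cinner x y"
  by (metis cinner_scaleC_left scaleC_of_real)

lemma cinner_scaleR_right: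
  fixes x y :: "'a::complex_inner"
  shows "cinner x (r *\<^sub>R y) = of_real r * cinner x y"
  by (metis cinner_scaleC_right scaleC_of_real complex_cnj_complex_of_real)

lemma cinner_minus_left:
  fixes x y :: "'a::complex_inner"
  shows "cinner (- x) y = - cinner x y"
  using cinner_scaleR_left[of "-1" x y] by simp

lemma cinner_minus_right:
  fixes x y :: "'a::complex_inner"
  shows "cinner x (- y) = - cinner x y"
  using cinner_scaleR_right[of x "-1" y] by simp

lemma cinner_diff_left:
  fixes x y z :: "'a::complex_inner"
  shows "cinner (x - y) z = cinner x z - cinner y z"
  using cinner_add_left[of x "- y" z] by (simp add: cinner_minus_left)

lemma cinner_diff_right:
  fixes x y z :: "'a::complex_inner"
  shows "cinner x (y - z) = cinner x y - cinner x z"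
  using cinner_add_right[of x y "- z"] by (simp add: cinner_minus_right)

lemmas cinner_simps =
  cinner_add_left cinner_add_right cinner_diff_left cinner_diff_right
  cinner_scaleC_left cinner_scaleC_right cinner_scaleR_left cinner_scaleR_right

lemma Re_cinner_commute:
  fixes x y :: "'a::complex_inner"
  shows "Re (cinner x y) = Re (cinner y x)"
  by (metis cinner_commute cnj.simps(1))

text \<open>Rotation by \<open>- \<i>\<close> turns an imaginary part into a real one, so that
  identities and bounds established for real parts carry over to the whole inner product.\<close>

lemma Im_cinner_eq:
  fixes x y :: "'a::complex_inner"
  shows "Im (cinner x y) = Re (cinner ((- \<i>) *\<^sub>C x) y)"
  by (simp add: cinner_scaleC_left)

lemma norm_power2_eq_cinner:
  fixes x :: "'a::complex_inner"
  shows "(norm x)\<^sup>2 = Re (cinner x x)"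
  by (simp add: norm_eq_sqrt_cinner cinner_self_nonneg)

lemma norm_scaleC:
  fixes x :: "'a::complex_inner"
  shows "norm (c *\<^sub>C x) = cmod c * norm x"
proof -
  have "cinner (c *\<^sub>C x) (c *\<^sub>C x) = of_real ((cmod c)\<^sup>2) * cinner x x"
    by (simp add: cinner_simps complex_norm_square mult_ac del: of_real_power)
  then have "(norm (c *\<^sub>C x))\<^sup>2 = (cmod c * norm x)\<^sup>2"
    by (simp only: norm_power2_eq_cinner[where 'a='a] power_mult_distrib) simp
  then show ?thesis by (simp only: power2_eq_iff_nonneg norm_ge_zero mult_nonneg_nonneg)
qed

lemma norm_add_power2:
  fixes x y :: "'a::complex_inner"
  shows "(norm (x + y))\<^sup>2 = (norm x)\<^sup>2 + 2 * Re (cinner x y) + (norm y)\<^sup>2"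
  using Re_cinner_commute[of x y] by (simp add: norm_power2_eq_cinner cinner_simps)

lemma norm_diff_power2:
  fixes x y :: "'a::complex_inner"
  shows "(norm (x - y))\<^sup>2 = (norm x)\<^sup>2 - 2 * Re (cinner x y) + (norm y)\<^sup>2"
  using Re_cinner_commute[of x y] by (simp add: norm_power2_eq_cinner cinner_simps)

lemma parallelogram_law:
  fixes x y :: "'a::complex_inner"
  shows "(norm (x + y))\<^sup>2 + (norm (x - y))\<^sup>2 = 2 * (norm x)\<^sup>2 + 2 * (norm y)\<^sup>2"
  by (simp add: norm_add_power2 norm_diff_power2)

text \<open>Cauchy-Schwarz for real parts. The triangle inequality is already available from the
  normed-space class, so the usual order of deduction is reversed: squaring it for
  \<open>x + y\<close> and \<open>x - y\<close> gives the two signs.\<close>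

lemma Re_cinner_le_norm_mult:
  fixes x y :: "'a::complex_inner"
  shows "\<bar>Re (cinner x y)\<bar> \<le> norm x * norm y"
proof -
  have up: "(norm (x + y))\<^sup>2 \<le> (norm x + norm y)\<^sup>2"
    by (intro power_mono norm_triangle_ineq) simp
  have dn: "(norm (x - y))\<^sup>2 \<le> (norm x + norm y)\<^sup>2"
    by (intro power_mono norm_triangle_ineq4) simp
  show ?thesis
    using up dn by (simp add: norm_add_power2 norm_diff_power2 power2_sum abs_le_iff)
qed

text \<open>Testing with \<open>x = u - v\<close> reduces this to definiteness. It serves to prove
  uniqueness and linearity of the adjoint.\<close>

lemma cinner_right_eqI:
  fixes u v :: "'a::complex_inner"
  assumes "\<And>x. cinner x u = cinner x v"
  shows "u = v"
proof -
  have "cinner (u - v) (u - v) = 0"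
    using assms[of "u - v"] by (simp add: cinner_diff_right)
  then show ?thesis by (simp add: cinner_self_eq_zero_iff)
qed

section \<open>The Riesz representation theorem and adjoints\<close>

text \<open>The first-order condition at a minimum: if \<open>p\<close> were nonzero, the step
  \<open>s = - p / m\<close> with \<open>m\<close> positive and larger than \<open>q\<close> would
  make the linear term win and the value negative.\<close>

lemma nonneg_quadratic_imp_linear_coeff_zero:
  fixes p q :: real
  assumes "\<And>s. 0 \<le> 2 * s * p + s\<^sup>2 * q"
  shows "p = 0"
proof (rule ccontr)
  assume "p \<noteq> 0"
  define m where "m = \<bar>q\<bar> + 1"
  have m: "m > 0" "q < m" unfolding m_def by auto
  have "0 \<le> 2 * (- p / m) * p + (- p / m)\<^sup>2 * q" by (rule assms)
  also have "\<dots> = (p\<^sup>2 / m) * (q / m - 2)"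
    using m by (simp add: field_simps power2_eq_square)
  also have "\<dots> < 0"
    using m \<open>p \<noteq> 0\<close> by (intro mult_pos_neg) (auto simp: field_simps)
  finally show False by simp
qed

text \<open>
  The representing vector minimises \<open>\<parallel>u\<parallel>\<^sup>2 - 2 f u\<close>; the parallelogram law makes every
  minimising sequence Cauchy.
\<close>

lemma riesz_representation_real:
  fixes f :: "'a::chilbert_space \<Rightarrow> real"
  assumes "bounded_linear f"
  shows "\<exists>u. \<forall>x. f x = Re (cinner x u)"
proof -
  interpret f: bounded_linear f by fact
  define J where "J u = (norm u)\<^sup>2 - 2 * f u" for u
  obtain K where K: "\<And>x. norm (f x) \<le> norm x * K"
    using f.bounded by blast
  \<comment> \<open>Completing the square: \<open>J u\<close> is at least
    \<open>(norm u - K)\<^sup>2 - K\<^sup>2\<close>.\<close>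
  have low: "- K\<^sup>2 \<le> J u" for u
  proof -
    have "f u \<le> norm u * K" using K[of u] by simp
    moreover have "0 \<le> (norm u - K)\<^sup>2" by simp
    ultimately show ?thesis by (simp add: J_def power2_diff)
  qed
  have bdd: "bdd_below (range J)" using low by (auto intro!: bdd_belowI)
  define m where "m = Inf (range J)"
  have m_le: "m \<le> J u" for u
    unfolding m_def using bdd by (simp add: cInf_lower)
  have "\<exists>u. J u < m + inverse (real (Suc n))" for n
    using cInf_lessD[of "range J" "m + inverse (real (Suc n))"] by (auto simp: m_def)
  then obtain U where U: "\<And>n. J (U n) < m + inverse (real (Suc n))" by metis
  \<comment> \<open>The midpoint of \<open>u\<close> and \<open>v\<close> cannot push
    \<open>J\<close> below \<open>m\<close>, so two near-minimisers must be close to each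
    other.\<close>
  have mid: "(norm (u - v))\<^sup>2 \<le> 2 * (J u - m) + 2 * (J v - m)" for u v
  proof -
    have "J ((1/2) *\<^sub>R (u + v)) = (norm (u + v))\<^sup>2 / 4 - (f u + f v)"
      by (simp only: J_def f.add f.scaleR norm_scaleR power_mult_distrib)
        (simp add: power2_eq_square field_simps)
    then have "J u + J v - 2 * J ((1/2) *\<^sub>R (u + v)) = (norm (u - v))\<^sup>2 / 2"
      using parallelogram_law[of u v] by (simp add: J_def)
    with m_le[of "(1/2) *\<^sub>R (u + v)"] show ?thesis by simp
  qed
  have "Cauchy U"
  proof (rule metric_CauchyI)
    fix e :: real assume e: "0 < e"
    obtain N where N: "inverse (real (Suc N)) < e\<^sup>2 / 4"
      using reals_Archimedean[of "e\<^sup>2 / 4"] e by auto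
    have near: "J (U n) - m < e\<^sup>2 / 4" if "n \<ge> N" for n
    proof -
      have "inverse (real (Suc n)) \<le> inverse (real (Suc N))"
        using that by (intro le_imp_inverse_le) auto
      then show ?thesis using U[of n] N by linarith
    qed
    show "\<exists>N. \<forall>i\<ge>N. \<forall>j\<ge>N. dist (U i) (U j) < e"
    proof (intro exI[of _ N] allI impI)
      fix i j assume "i \<ge> N" "j \<ge> N"
      then have "(norm (U i - U j))\<^sup>2 < e\<^sup>2"
        using mid[of "U i" "U j"] near[of i] near[of j] by simp
      then show "dist (U i) (U j) < e"
        using e by (simp add: dist_norm power_less_imp_less_base)
    qed
  qed
  then obtain u where u: "U \<longlonglongrightarrow> u"
    using Cauchy_convergent convergent_def by blast
  have "(\<lambda>n. J (U n)) \<longlonglongrightarrow> J u"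
    unfolding J_def by (intro tendsto_intros u f.tendsto)
  moreover have "(\<lambda>n. m + inverse (real (Suc n))) \<longlonglongrightarrow> m + 0"
    by (intro tendsto_intros LIMSEQ_inverse_real_of_nat)
  ultimately have "J u \<le> m + 0"
    using U by (intro LIMSEQ_le) (auto intro: less_imp_le)
  have "f x = Re (cinner x u)" for x
  proof -
    \<comment> \<open>The right-hand side is \<open>J (u + s *\<^sub>R x) - J u\<close>, nonnegative
      because \<open>u\<close> attains the infimum.\<close>
    have "0 \<le> 2 * s * (Re (cinner u x) - f x) + s\<^sup>2 * (norm x)\<^sup>2" for s
    proof -
      have "J u \<le> J (u + s *\<^sub>R x)"
        using m_le \<open>J u \<le> m + 0\<close> by (metis add.right_neutral order_trans)
      then show ?thesis
        by (simp add: J_def norm_add_power2 f.add f.scaleR cinner_scaleR_right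
            power_mult_distrib algebra_simps)
    qed
    then have "Re (cinner u x) - f x = 0"
      by (rule nonneg_quadratic_imp_linear_coeff_zero)
    then show ?thesis by (simp add: Re_cinner_commute[of x u])
  qed
  then show ?thesis by blast
qed

section \<open>Existence and boundedness of the adjoint\<close>

lemma bounded_linear_Re_cinner_left:
  fixes A :: "'a::complex_inner \<Rightarrow> 'a"
  assumes "bounded_linear A"
  shows "bounded_linear (\<lambda>x. Re (cinner (A x) y))"
proof -
  have "bounded_linear (\<lambda>x::'a. Re (cinner x y))"
    by (rule bounded_linear_intro[of _ "norm y"])
      (simp_all add: cinner_simps Re_cinner_le_norm_mult)
  then show ?thesis using assms by (rule bounded_linear_compose)
qed

text \<open>For each fixed \<open>y\<close>, Riesz represents the real functional
  \<open>Re (cinner (A x) y)\<close>. Complex linearity of \<open>A\<close> allows \<open>x\<close>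
  to be replaced by \<open>(- \<i>) *\<^sub>C x\<close>, which supplies the imaginary part;
  uniqueness then identifies the definite description with the operator found.\<close>

lemma cinner_cadjoint_right:
  fixes A :: "'a::chilbert_space \<Rightarrow> 'a"
  assumes "bounded_clinear A"
  shows "cinner x (cadjoint A y) = cinner (A x) y"
proof -
  have A: "bounded_linear A" and AC: "\<And>c x. A (c *\<^sub>C x) = c *\<^sub>C A x"
    using assms by (auto simp: bounded_clinear_def)
  have "\<exists>u. \<forall>x. Re (cinner (A x) y) = Re (cinner x u)" for y
    by (intro riesz_representation_real bounded_linear_Re_cinner_left A)
  then obtain B where B: "\<And>x y. Re (cinner (A x) y) = Re (cinner x (B y))" by metis
  have B': "cinner (A x) y = cinner x (B y)" for x y
    using B by (intro complex_eqI) (simp_all only: Im_cinner_eq AC[symmetric])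
  have "cadjoint A = B"
    unfolding cadjoint_def
  proof (rule the_equality)
    fix C assume "\<forall>x y. cinner (A x) y = cinner x (C y)"
    then show "C = B" using B' by (metis cinner_right_eqI ext)
  qed (simp add: B')
  then show ?thesis by (simp add: B')
qed

lemma cinner_cadjoint_left:
  fixes A :: "'a::chilbert_space \<Rightarrow> 'a"
  assumes "bounded_clinear A"
  shows "cinner (cadjoint A x) y = cinner x (A y)"
  by (metis assms cinner_cadjoint_right cinner_commute)

text \<open>Linearity is read off by testing against all vectors. For the bound, the squared norm of
  \<open>cadjoint A x\<close> equals \<open>Re (cinner (A (cadjoint A x)) x)\<close>, and one factor
  \<open>norm (cadjoint A x)\<close> cancels after Cauchy-Schwarz.\<close>

lemma bounded_linear_cadjoint:
  fixes A :: "'a::chilbert_space \<Rightarrow> 'a"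
  assumes "bounded_clinear A"
  shows "bounded_linear (cadjoint A)"
proof -
  note adj = cinner_cadjoint_right[OF assms]
  obtain K where K: "K > 0" "\<And>x. norm (A x) \<le> norm x * K"
    using assms bounded_linear.pos_bounded unfolding bounded_clinear_def by blast
  show ?thesis
  proof (rule bounded_linear_intro[of _ K])
    fix x y r
    show "cadjoint A (x + y) = cadjoint A x + cadjoint A y"
      by (rule cinner_right_eqI) (simp add: adj cinner_simps)
    show "cadjoint A (r *\<^sub>R x) = r *\<^sub>R cadjoint A x"
      by (rule cinner_right_eqI) (simp add: adj cinner_simps)
    let ?B = "cadjoint A x"
    have "norm ?B * norm ?B = Re (cinner (A ?B) x)"
      using norm_power2_eq_cinner[of ?B] by (simp add: adj power2_eq_square)
    also have "\<dots> \<le> norm (A ?B) * norm x"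
      using Re_cinner_le_norm_mult[of "A ?B" x] by simp
    also have "\<dots> \<le> norm ?B * (norm x * K)"
      using mult_right_mono[OF K(2)[of ?B], of "norm x"] by (simp add: mult_ac)
    finally show "norm ?B \<le> norm x * K"
      using K(1) by (cases "norm ?B = 0") (auto simp: mult_le_cancel_left)
  qed
qed

section \<open>Real and imaginary parts of an operator\<close>

lemma bounded_linear_scaleC: "bounded_linear (\<lambda>x::'a::complex_inner. c *\<^sub>C x)"
proof (rule bounded_linear_intro[of _ "cmod c"])
  fix r and x :: 'a
  show "c *\<^sub>C (r *\<^sub>R x) = r *\<^sub>R (c *\<^sub>C x)"
    by (simp add: scaleC_of_real[symmetric] scaleC_scaleC mult.commute)
qed (simp_all add: scaleC_add_right norm_scaleC mult.commute)

lemma bounded_linear_Re_op: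
  assumes "bounded_clinear A"
  shows "bounded_linear (Re_op A)"
  unfolding Re_op_def
  using assms
  by (intro bounded_linear_compose[OF bounded_linear_scaleC] bounded_linear_add
      bounded_linear_cadjoint) (auto simp: bounded_clinear_def)

lemma bounded_linear_Im_op:
  assumes "bounded_clinear A"
  shows "bounded_linear (Im_op A)"
  unfolding Im_op_def
  using assms
  by (intro bounded_linear_compose[OF bounded_linear_scaleC] bounded_linear_sub
      bounded_linear_cadjoint) (auto simp: bounded_clinear_def)

lemma cinner_Re_op_symmetric:
  assumes "bounded_clinear A"
  shows "cinner (Re_op A x) y = cinner x (Re_op A y)"
  by (simp add: Re_op_def cinner_simps cinner_cadjoint_left[OF assms]
      cinner_cadjoint_right[OF assms])

lemma cinner_Im_op_symmetric:
  assumes "bounded_clinear A"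
  shows "cinner (Im_op A x) y = cinner x (Im_op A y)"
  by (simp add: Im_op_def cinner_simps cinner_cadjoint_left[OF assms]
      cinner_cadjoint_right[OF assms] field_simps)

lemma cinner_cadjoint_self:
  assumes "bounded_clinear A"
  shows "cinner (cadjoint A x) x = cnj (cinner (A x) x)"
  by (metis assms cinner_cadjoint_left cinner_commute)

lemma cinner_Re_op_self:
  assumes "bounded_clinear A"
  shows "cinner (Re_op A x) x = of_real (Re (cinner (A x) x))"
  by (simp add: Re_op_def cinner_simps cinner_cadjoint_self[OF assms] complex_eq_iff)

lemma cinner_Im_op_self:
  assumes "bounded_clinear A"
  shows "cinner (Im_op A x) x = of_real (Im (cinner (A x) x))"
  by (simp add: Im_op_def cinner_simps cinner_cadjoint_self[OF assms] complex_eq_iff Re_divide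
      Im_divide power2_eq_square)

section \<open>Numerical radius\<close>

text \<open>Quadratic homogeneity extends the bound from unit vectors to all nonzero vectors.
  Nonnegativity comes from the element 0 inserted into the supremum, hence holds on the zero space
  too.\<close>

lemma numerical_radius_upper:
  fixes T :: "'a::chilbert_space \<Rightarrow> 'a"
  assumes "bounded_linear T"
  shows "cmod (cinner (T x) x) \<le> numerical_radius T * (norm x)\<^sup>2"
    and "0 \<le> numerical_radius T"
proof -
  obtain K where K: "\<And>x. norm (T x) \<le> norm x * K"
    using assms bounded_linear.bounded by blast
  let ?S = "insert 0 {cmod (cinner (T x) x) | x. norm x = 1}"
  \<comment> \<open>Only finiteness of the supremum is at stake, so real and imaginary parts are
    each bounded by \<open>\<bar>K\<bar>\<close> and added.\<close>
  have "cmod (cinner (T x) x) \<le> 2 * \<bar>K\<bar>" if "norm x = 1" for x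
  proof -
    have "norm (T x) \<le> \<bar>K\<bar>" using K[of x] that by simp
    moreover have "\<bar>Re (cinner (T x) x)\<bar> \<le> norm (T x)"
      using Re_cinner_le_norm_mult[of "T x" x] that by simp
    moreover have "\<bar>Im (cinner (T x) x)\<bar> \<le> norm (T x)"
      using Re_cinner_le_norm_mult[of "(- \<i>) *\<^sub>C T x" x] that
      by (simp only: Im_cinner_eq norm_scaleC) simp
    ultimately show ?thesis using cmod_le[of "cinner (T x) x"] by linarith
  qed
  then have bdd: "bdd_above ?S" by (auto intro!: bdd_aboveI[of _ "2 * \<bar>K\<bar>"])
  show nonneg: "0 \<le> numerical_radius T"
    unfolding numerical_radius_def using bdd by (intro cSup_upper) auto
  show "cmod (cinner (T x) x) \<le> numerical_radius T * (norm x)\<^sup>2"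
  proof (cases "x = 0")
    case True
    then show ?thesis using cinner_scaleR_right[of "T x" 0 x] by simp
  next
    case False
    define e where "e = (1 / norm x) *\<^sub>R x"
    have x: "x = norm x *\<^sub>R e" and "norm e = 1" using False by (auto simp: e_def)
    then have le: "cmod (cinner (T e) e) \<le> numerical_radius T"
      unfolding numerical_radius_def using bdd by (intro cSup_upper) auto
    have "T x = norm x *\<^sub>R T e"
      using x bounded_linear.linear[OF assms] by (metis linear_cmul)
    then have "cinner (T x) x = of_real ((norm x)\<^sup>2) * cinner (T e) e"
      using x by (metis cinner_scaleR_left cinner_scaleR_right mult.assoc of_real_mult
          power2_eq_square)
    then show ?thesis using le
      by (simp add: norm_mult mult.commute mult_right_mono norm_power)
  qed
qed

text \<open>By symmetry, polarization writes \<open>4 * Re (cinner (T x) y)\<close> as a difference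
  of two values of the quadratic form; the bound on the form and the parallelogram law then control
  it.\<close>

lemma onorm_symmetric_le:
  fixes T :: "'a::complex_inner \<Rightarrow> 'a"
  assumes "linear T"
    and sym: "\<And>x y. cinner (T x) y = cinner x (T y)"
    and bound: "\<And>x. \<bar>Re (cinner (T x) x)\<bar> \<le> c * (norm x)\<^sup>2"
    and "0 \<le> c"
  shows "onorm T \<le> c"
proof (rule onorm_bound[OF \<open>0 \<le> c\<close>])
  fix x
  interpret T: linear T by fact
  have polar: "4 * Re (cinner (T x) y) \<le> 2 * c * ((norm x)\<^sup>2 + (norm y)\<^sup>2)" for y
  proof -
    have "Re (cinner (T y) x) = Re (cinner (T x) y)"
      by (simp add: sym[of y x] Re_cinner_commute[of y "T x"])
    then have "4 * Re (cinner (T x) y)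
        = Re (cinner (T (x + y)) (x + y)) - Re (cinner (T (x - y)) (x - y))"
      by (simp add: T.add T.diff cinner_simps)
    also have "\<dots> \<le> c * (norm (x + y))\<^sup>2 + c * (norm (x - y))\<^sup>2"
      using bound[of "x + y"] bound[of "x - y"] by linarith
    also have "\<dots> = 2 * c * ((norm x)\<^sup>2 + (norm y)\<^sup>2)"
      using arg_cong[OF parallelogram_law[of x y], of "(*) c"] by (simp add: algebra_simps)
    finally show ?thesis .
  qed
  show "norm (T x) \<le> c * norm x"
  proof (cases "T x = 0")
    case True
    then show ?thesis using \<open>0 \<le> c\<close> by simp
  next
    case False
    then have "norm x > 0" using T.zero by auto
    \<comment> \<open>\<open>y\<close> points along \<open>T x\<close>, making the inner product as
      large as possible, and is scaled to the length of \<open>x\<close>, so that the two squares in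
      \<open>polar\<close> coincide.\<close>
    define y where "y = (norm x / norm (T x)) *\<^sub>R T x"
    have "norm y = norm x" using False by (simp add: y_def)
    moreover have "Re (cinner (T x) y) = norm x * norm (T x)"
      using False norm_power2_eq_cinner[of "T x"]
      by (simp add: y_def cinner_scaleR_right power2_eq_square field_simps)
    ultimately have "norm x * norm (T x) \<le> norm x * (c * norm x)"
      using polar[of y] by (simp add: power2_eq_square mult_ac)
    then show ?thesis using \<open>norm x > 0\<close> by simp
  qed
qed

section \<open>The weighted inequality\<close>

lemma weighted_sum_le_cmod:
  assumes "0 \<le> t" "t \<le> 1"
  shows "2 * (sqrt ((1 - t) ^ 3) * r + sqrt (t ^ 3) * s)
    \<le> cmod (Complex (2 * (1 - t) * r) (2 * t * s))"
proof -
  have cube: "sqrt (u ^ 3) = sqrt u * u" if "0 \<le> u" for u :: real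
    using that by (simp add: power3_eq_cube real_sqrt_mult)
  have "sqrt ((1 - t) ^ 3) * r + sqrt (t ^ 3) * s
      = sqrt (1 - t) * ((1 - t) * r) + sqrt t * (t * s)"
    using assms by (simp add: cube)
  \<comment> \<open>In the instance \<open>complex\<close>, \<open>Re (cinner x y)\<close> is the
    dot product of the plane, and \<open>Complex (sqrt (1 - t)) (sqrt t)\<close> has modulus
    1.\<close>
  also have "\<dots> \<le> cmod (Complex ((1 - t) * r) (t * s))"
    using Re_cinner_le_norm_mult[of "Complex ((1 - t) * r) (t * s)" "Complex (sqrt (1 - t)) (sqrt t)"]
      assms
    by (simp add: cinner_complex_def cmod_def[of "Complex (sqrt (1 - t)) (sqrt t)"] mult_ac)
  finally have "2 * (sqrt ((1 - t) ^ 3) * r + sqrt (t ^ 3) * s)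
      \<le> cmod (2 * Complex ((1 - t) * r) (t * s))"
    by (simp add: norm_mult)
  also have "2 * Complex ((1 - t) * r) (t * s) = Complex (2 * (1 - t) * r) (2 * t * s)"
    by (simp add: complex_eq_iff)
  finally show ?thesis .
qed

text \<open>The sign \<open>e\<close> treats \<open>a R + b I\<close> and \<open>a R - b I\<close> at once.\<close>

lemma onorm_combination_le_weighted_numerical_radius:
  fixes A :: "'a::chilbert_space \<Rightarrow> 'a"
  assumes A: "bounded_clinear A" and t: "0 \<le> t" "t \<le> 1" and e: "\<bar>e\<bar> = 1"
  shows "2 * onorm (\<lambda>x. sqrt ((1 - t) ^ 3) *\<^sub>R Re_op A x + (e * sqrt (t ^ 3)) *\<^sub>R Im_op A x)
    \<le> weighted_numerical_radius t A"
proof -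
  let ?a = "sqrt ((1 - t) ^ 3)" and ?b = "sqrt (t ^ 3)"
  let ?T = "\<lambda>x. ?a *\<^sub>R Re_op A x + (e * ?b) *\<^sub>R Im_op A x"
  let ?W = "\<lambda>x. (1 - 2 * t) *\<^sub>R cadjoint A x + A x"
  let ?w = "weighted_numerical_radius t A"
  have lin: "bounded_linear ?T"
    by (intro bounded_linear_add bounded_linear_const_scaleR bounded_linear_Re_op
        bounded_linear_Im_op A)
  have "bounded_linear ?W"
    using A by (intro bounded_linear_add bounded_linear_const_scaleR bounded_linear_cadjoint)
      (auto simp: bounded_clinear_def)
  note w = numerical_radius_upper[OF this, folded weighted_numerical_radius_def]
  have "onorm ?T \<le> ?w / 2"
  proof (rule onorm_symmetric_le)
    show "linear ?T" using lin by (rule bounded_linear.linear)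
    show "cinner (?T x) y = cinner x (?T y)" for x y
      by (simp add: cinner_simps cinner_Re_op_symmetric[OF A] cinner_Im_op_symmetric[OF A])
    show "0 \<le> ?w / 2" using w(2) by simp
  next
    fix x
    define r s where "r = Re (cinner (A x) x)" and "s = Im (cinner (A x) x)"
    \<comment> \<open>With \<open>z = cinner (A x) x\<close> this is
      \<open>(1 - 2 * t) * cnj z + z\<close>: the real part gains the factor
      \<open>2 - 2 * t\<close>, the imaginary part \<open>2 * t\<close>.\<close>
    have "cinner (?W x) x = Complex (2 * (1 - t) * r) (2 * t * s)"
      by (simp add: cinner_simps cinner_cadjoint_self[OF A] complex_eq_iff r_def s_def
          algebra_simps)
    then have W: "cmod (Complex (2 * (1 - t) * r) (2 * t * s)) \<le> ?w * (norm x)\<^sup>2"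
      using w(1)[of x] by simp
    have T: "Re (cinner (?T x) x) = ?a * r + ?b * (e * s)"
      by (simp add: cinner_simps cinner_Re_op_self[OF A] cinner_Im_op_self[OF A] r_def s_def)
    have "e\<^sup>2 = 1" using e by (metis power2_abs power_one)
    \<comment> \<open>The values 1 and -1 of \<open>d\<close> give the two signs needed for the
      absolute value; neither \<open>d\<close> nor \<open>e\<close> changes the modulus.\<close>
    then have eq: "cmod (Complex (2 * (1 - t) * (d * r)) (2 * t * (d * (e * s))))
        = cmod (Complex (2 * (1 - t) * r) (2 * t * s))" if "d\<^sup>2 = 1" for d
      using that by (simp add: cmod_def power_mult_distrib)
    show "\<bar>Re (cinner (?T x) x)\<bar> \<le> ?w / 2 * (norm x)\<^sup>2"
      using weighted_sum_le_cmod[OF t, of "1 * r" "1 * (e * s)"]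
        weighted_sum_le_cmod[OF t, of "- 1 * r" "- 1 * (e * s)"] eq[of 1] eq[of "- 1"] W
      unfolding T by (simp add: abs_if)
  qed
  then show ?thesis by simp
qed

lemma weighted_numerical_radius_lower_bound:
  fixes A :: "'a::chilbert_space \<Rightarrow> 'a"
  assumes A: "bounded_clinear A" and t: "0 \<le> t" "t \<le> 1"
  shows "2 * sqrt ((1 - t) ^ 3) * onorm (Re_op A)
      + \<bar>onorm (\<lambda>x. sqrt ((1 - t) ^ 3) *\<^sub>R Re_op A x + sqrt (t ^ 3) *\<^sub>R Im_op A x)
         - onorm (\<lambda>x. sqrt ((1 - t) ^ 3) *\<^sub>R Re_op A x - sqrt (t ^ 3) *\<^sub>R Im_op A x)\<bar>
      \<le> weighted_numerical_radius t A"
proof -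
  define a b where "a = sqrt ((1 - t) ^ 3)" and "b = sqrt (t ^ 3)"
  let ?S = "\<lambda>x. a *\<^sub>R Re_op A x + b *\<^sub>R Im_op A x"
  let ?D = "\<lambda>x. a *\<^sub>R Re_op A x - b *\<^sub>R Im_op A x"
  have "bounded_linear ?S" "bounded_linear ?D"
    by (intro bounded_linear_add bounded_linear_sub bounded_linear_const_scaleR
        bounded_linear_Re_op bounded_linear_Im_op A)+
  then have "onorm (\<lambda>x. ?S x + ?D x) \<le> onorm ?S + onorm ?D"
    by (rule onorm_triangle)
  moreover have "(\<lambda>x. ?S x + ?D x) = (\<lambda>x. (2 * a) *\<^sub>R Re_op A x)"
    by (simp add: scaleR_2[symmetric])
  moreover have "0 \<le> a" using t by (simp add: a_def)
  ultimately have "2 * a * onorm (Re_op A) \<le> onorm ?S + onorm ?D"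
    using onorm_scaleR[OF bounded_linear_Re_op[OF A], of "2 * a"] by simp
  moreover have "2 * onorm ?S \<le> weighted_numerical_radius t A"
    using onorm_combination_le_weighted_numerical_radius[OF A t, of 1] by (simp add: a_def b_def)
  moreover have "2 * onorm ?D \<le> weighted_numerical_radius t A"
    using onorm_combination_le_weighted_numerical_radius[OF A t, of "- 1"]
    by (simp add: a_def b_def)
  \<comment> \<open>Whichever norm is larger, their sum plus the absolute difference is twice that
    norm.\<close>
  ultimately show ?thesis unfolding a_def[symmetric] b_def[symmetric] by linarith
qed

theorem corollary2p5:
  fixes A :: "'a::chilbert_space \<Rightarrow> 'a"
  assumes "bounded_clinear A"
  shows
    "(\<forall>t::real. 0 \<le> t \<and> t \<le> 1 \<longrightarrow>
        2 * sqrt ((1 - t) ^ 3) * onorm (Re_op A)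
        + \<bar>onorm (\<lambda>x. sqrt ((1 - t) ^ 3) *\<^sub>R Re_op A x + sqrt (t ^ 3) *\<^sub>R Im_op A x)
           - onorm (\<lambda>x. sqrt ((1 - t) ^ 3) *\<^sub>R Re_op A x - sqrt (t ^ 3) *\<^sub>R Im_op A x)\<bar>
        \<le> weighted_numerical_radius t A)
     \<and> 1 / sqrt 2 * onorm (Re_op A)
        + 1 / (2 * sqrt 2)
          * \<bar>onorm (\<lambda>x. Re_op A x + Im_op A x) - onorm (\<lambda>x. Re_op A x - Im_op A x)\<bar>
        \<le> numerical_radius A"
proof (intro conjI allI impI)
  fix t :: real
  assume "0 \<le> t \<and> t \<le> 1"
  then show "2 * sqrt ((1 - t) ^ 3) * onorm (Re_op A)
      + \<bar>onorm (\<lambda>x. sqrt ((1 - t) ^ 3) *\<^sub>R Re_op A x + sqrt (t ^ 3) *\<^sub>R Im_op A x)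
         - onorm (\<lambda>x. sqrt ((1 - t) ^ 3) *\<^sub>R Re_op A x - sqrt (t ^ 3) *\<^sub>R Im_op A x)\<bar>
      \<le> weighted_numerical_radius t A"
    by (intro weighted_numerical_radius_lower_bound assms) auto
next
  \<comment> \<open>At \<open>t = 1/2\<close> both coefficients equal \<open>c\<close>, which then
    factors out of the operator norms and the absolute value.\<close>
  define c :: real where "c = 1 / (2 * sqrt 2)"
  have "0 \<le> c" by (simp add: c_def)
  have root: "sqrt ((1 / 2) ^ 3) = c"
    by (rule real_sqrt_unique) (simp_all add: c_def power2_eq_square power3_eq_cube)
  \<comment> \<open>The coefficient \<open>1 - 2 * t\<close> of the adjoint vanishes here.\<close>
  have half: "weighted_numerical_radius (1 / 2) A = numerical_radius A"
    by (simp add: weighted_numerical_radius_def)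
  have lin: "bounded_linear (\<lambda>x. Re_op A x + Im_op A x)"
    "bounded_linear (\<lambda>x. Re_op A x - Im_op A x)"
    by (intro bounded_linear_add bounded_linear_sub bounded_linear_Re_op bounded_linear_Im_op
        assms)+
  have "2 * c * onorm (Re_op A)
      + \<bar>onorm (\<lambda>x. c *\<^sub>R Re_op A x + c *\<^sub>R Im_op A x)
         - onorm (\<lambda>x. c *\<^sub>R Re_op A x - c *\<^sub>R Im_op A x)\<bar> \<le> numerical_radius A"
    using weighted_numerical_radius_lower_bound[OF assms, of "1 / 2"]
    by (simp add: root half del: power_one_over real_sqrt_power)
  moreover have "onorm (\<lambda>x. c *\<^sub>R Re_op A x + c *\<^sub>R Im_op A x)
      = c * onorm (\<lambda>x. Re_op A x + Im_op A x)"
    using onorm_scaleR[OF lin(1), of c] \<open>0 \<le> c\<close> by (simp add: scaleR_add_right)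
  moreover have "onorm (\<lambda>x. c *\<^sub>R Re_op A x - c *\<^sub>R Im_op A x)
      = c * onorm (\<lambda>x. Re_op A x - Im_op A x)"
    using onorm_scaleR[OF lin(2), of c] \<open>0 \<le> c\<close> by (simp add: scaleR_diff_right)
  moreover have "\<bar>c * p - c * q\<bar> = c * \<bar>p - q\<bar>" for p q
    using \<open>0 \<le> c\<close> by (metis abs_mult abs_of_nonneg right_diff_distrib)
  moreover have "1 / sqrt 2 = 2 * c" by (simp add: c_def)
  moreover note c_def[symmetric]
  ultimately show "1 / sqrt 2 * onorm (Re_op A)
      + 1 / (2 * sqrt 2)
        * \<bar>onorm (\<lambda>x. Re_op A x + Im_op A x) - onorm (\<lambda>x. Re_op A x - Im_op A x)\<bar>
      \<le> numerical_radius A"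
    by (simp only:)
qed

end
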